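(* Let $\mathcal E$ be the pattern of vertices of equilateral triangles in $\mathbb R^2$. Then for every positive integer $n$, \[ S_{\mathcal E}(n) \le \left\lfloor \frac{(4n-1)(n-1)}{18} \right\rfloor . \]
   Context: Identify $\mathbb R^2$ with $\mathbb C$. $\mathcal E$ is the set of all $3$-element subsets $\{a,b,c\}\subseteq\mathbb C$ whose three pairwise distances are equal (vertex sets of equilateral triangles). For a finite $V\subseteq\mathbb C$, $S_{\mathcal E}(V)$ is the number of sets $P\in\mathcal E$ with $P\subseteq V$, and $S_{\mathcal E}(n)=\max\{S_{\mathcal E}(V): V\subseteq \mathbb C,\ |V|=n\}$, the maximum number of equilateral triangles whose vertices all lie in an $n$-point subset of the plane. *)

theory Defs
  imports "HOL-Analysis.Analysis"
begin

definition equilateral_sets :: "complex set set" where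
  "equilateral_sets = {P. \<exists>a b c. P = {a, b, c} \<and> card P = 3 \<and>
       dist a b = dist b c \<and> dist b c = dist a c}"

definition S_E_set :: "complex set \<Rightarrow> nat" where
  "S_E_set V = card {P \<in> equilateral_sets. P \<subseteq> V}"

definition S_E :: "nat \<Rightarrow> nat" where
  "S_E n = Max {S_E_set V | V. finite V \<and> card V = n}"

end

theory Submission
  imports Defs
begin

text \<open>
  Fix a total order on \<open>\<complex>\<close> that is compatible with addition, and consider its three rotations
  by multiples of \<open>120\<close> degrees. A point \<open>v \<in> V\<close> has \<open>a\<^sub>j\<close> points above and \<open>b\<^sub>j\<close> points below it in
  the \<open>j\<close>-th order. A triangle at \<open>v\<close> is given by a point \<open>u\<close> and its rotation \<open>u'\<close> about \<open>v\<close>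
  by \<open>60\<close> degrees; if \<open>u\<close> is not above \<open>v\<close> in one order then \<open>u'\<close> is above \<open>v\<close> in another one. Hence
  the number of triangles at \<open>v\<close> is at most \<open>a\<^sub>i + a\<^sub>j\<close>, and likewise at most \<open>b\<^sub>i + b\<^sub>j\<close>, for \<open>i \<noteq> j\<close>.
  Put \<open>t\<^sub>j = min a\<^sub>j b\<^sub>j\<close>. Two of the three minima are attained on the same side, so the degree of \<open>v\<close>
  is at most \<open>t\<^sub>0 + t\<^sub>1 + t\<^sub>2\<close> minus the smallest \<open>t\<^sub>j\<close>. For each \<open>j\<close> the value
  \<open>t\<^sub>j\<close> is taken by at most two points, so a given minimum occurs at most six times; bounding
  the minimum below by means of a threshold \<open>q = n div 6\<close> and summing over \<open>v\<close> gives the claim.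
\<close>

section \<open>Lexicographic order on the plane and ranks in its rotations\<close>

definition lex_pos :: "complex \<Rightarrow> bool" where
  "lex_pos z \<longleftrightarrow> 0 < Re z \<or> Re z = 0 \<and> 0 < Im z"

lemma not_lex_pos_0 [simp]: "\<not> lex_pos 0"
  by (simp add: lex_pos_def)

lemma lex_pos_add: "lex_pos x \<Longrightarrow> lex_pos y \<Longrightarrow> lex_pos (x + y)"
  by (auto simp: lex_pos_def)

lemma lex_pos_minus_iff: "z \<noteq> 0 \<Longrightarrow> lex_pos (- z) \<longleftrightarrow> \<not> lex_pos z"
  by (auto simp: lex_pos_def complex_eq_iff)

text \<open>The factor \<open>c\<close> turns the order, and \<open>- c\<close> reverses it, so
  \<open>num_above V (- c) v\<close> counts the points below \<open>v\<close>.\<close>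

definition num_above :: "complex set \<Rightarrow> complex \<Rightarrow> complex \<Rightarrow> nat" where
  "num_above V c v = card {u \<in> V. lex_pos (c * (u - v))}"

lemma num_above_add_minus:
  assumes "finite V" "v \<in> V" "c \<noteq> 0"
  shows "num_above V c v + num_above V (- c) v = card V - 1"
proof -
  have "{u \<in> V. lex_pos (- c * (u - v))} = {u \<in> V. u \<noteq> v \<and> \<not> lex_pos (c * (u - v))}"
  proof -
    have "lex_pos (- c * (u - v)) \<longleftrightarrow> u \<noteq> v \<and> \<not> lex_pos (c * (u - v))" for u
      using assms(3) lex_pos_minus_iff[of "c * (u - v)"] by (cases "u = v") auto
    then show ?thesis by simp
  qed
  moreover have "{u \<in> V. lex_pos (c * (u - v))} \<union> {u \<in> V. u \<noteq> v \<and> \<not> lex_pos (c * (u - v))} = V - {v}"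
    by auto
  moreover have "{u \<in> V. lex_pos (c * (u - v))} \<inter> {u \<in> V. u \<noteq> v \<and> \<not> lex_pos (c * (u - v))} = {}"
    by auto
  ultimately show ?thesis
    unfolding num_above_def using assms by (subst card_Un_disjoint[symmetric]) auto
qed

lemma num_above_less:
  assumes "finite V" "y \<in> V" "lex_pos (c * (y - x))"
  shows "num_above V c y < num_above V c x"
  unfolding num_above_def
proof (rule psubset_card_mono)
  have "lex_pos (c * (u - x))" if "lex_pos (c * (u - y))" for u
    using lex_pos_add[OF that assms(3)] by (simp add: algebra_simps)
  moreover have "y \<in> {u \<in> V. lex_pos (c * (u - x))}" "y \<notin> {u \<in> V. lex_pos (c * (u - y))}"
    using assms by auto
  ultimately show "{u \<in> V. lex_pos (c * (u - y))} \<subset> {u \<in> V. lex_pos (c * (u - x))}"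
    by blast
qed (use assms in auto)

text \<open>Distinct points are comparable, since ties in the real part are broken, and a higher
  point has strictly fewer points above it. So the counts are ranks, and sums over \<open>V\<close>
  can be reindexed by \<open>k < card V\<close>.\<close>

lemma bij_betw_num_above:
  assumes "finite V" "c \<noteq> 0"
  shows "bij_betw (num_above V c) V {..<card V}"
proof -
  have inj: "inj_on (num_above V c) V"
  proof (rule inj_onI, rule ccontr)
    fix x y assume xy: "x \<in> V" "y \<in> V" "num_above V c x = num_above V c y" "x \<noteq> y"
    have "lex_pos (c * (y - x)) \<or> lex_pos (c * (x - y))"
      using lex_pos_minus_iff[of "c * (y - x)"] xy(4) assms(2) by (auto simp: algebra_simps)
    then show False
      using num_above_less[OF assms(1), of _ c] xy by fastforce
  qed
  have "num_above V c v < card V" if "v \<in> V" for v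
    using num_above_add_minus[OF assms(1) that assms(2)] that assms(1)
      card_gt_0_iff[of V] by (cases "card V") auto
  then have "num_above V c ` V \<subseteq> {..<card V}" by auto
  then show ?thesis
    using inj by (simp add: bij_betw_def card_image card_subset_eq)
qed

section \<open>Equilateral triangles via a primitive sixth root of unity\<close>

definition rot60 :: complex where "rot60 = Complex (1/2) (sqrt 3 / 2)"

lemma rot60_sq: "rot60\<^sup>2 = rot60 - 1"
  by (simp add: rot60_def complex_eq_iff power2_eq_square)

lemma rot60_nonzero [simp]: "rot60 \<noteq> 0"
  by (simp add: rot60_def complex_eq_iff)

lemma rot60_cube: "rot60 ^ 3 = - 1"
proof -
  have "rot60 ^ 3 = rot60 * (rot60 - 1)" by (simp add: power3_eq_cube flip: rot60_sq power2_eq_square)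
  also have "\<dots> = rot60\<^sup>2 - rot60" by (simp add: power2_eq_square right_diff_distrib)
  finally show ?thesis by (simp add: rot60_sq)
qed

text \<open>Normalising \<open>v\<close> to 0 and \<open>u\<close> to 1 puts the third vertex
  \<open>z\<close> on the unit circles about 0 and 1, which meet only in \<open>rot60\<close> and
  its conjugate.\<close>

lemma equilateral_rot60:
  assumes "dist v u = dist u w" "dist u w = dist v w" "u \<noteq> v"
  shows "w = v + rot60 * (u - v) \<or> u = v + rot60 * (w - v)"
proof -
  define z where "z = (w - v) / (u - v)"
  have w: "w - v = z * (u - v)" using assms(3) by (simp add: z_def)
  have pos: "cmod (u - v) > 0" using assms(3) by simp
  have "cmod (w - v) = cmod (u - v)" 
    using assms(1,2) by (metis dist_norm dist_commute)
  then have 1: "cmod z = 1" using pos by (simp add: w norm_mult)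
  have "(z - 1) * (u - v) = w - u" using w by (simp add: algebra_simps)
  moreover have "cmod (w - u) = cmod (u - v)"
    using assms(1,2) by (metis dist_norm dist_commute)
  ultimately have 2: "cmod (z - 1) = 1" using pos by (metis norm_mult mult_cancel_right2 less_irrefl)
  have e1: "(Re z)\<^sup>2 + (Im z)\<^sup>2 = 1" using 1 cmod_power2[of z] by simp
  have e2: "(Re z - 1)\<^sup>2 + (Im z)\<^sup>2 = 1" using 2 cmod_power2[of "z - 1"] by simp
  have re: "Re z = 1/2" using e1 e2 by (simp add: power2_eq_square algebra_simps)
  have "(Im z)\<^sup>2 = (sqrt 3 / 2)\<^sup>2" using e1 by (simp add: re power2_eq_square)
  then have "Im z = sqrt 3 / 2 \<or> Im z = - (sqrt 3 / 2)" by (simp only: power2_eq_iff)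
  \<comment> \<open>The conjugate of \<open>rot60\<close> is its inverse; this case is the same
    rotation with \<open>u\<close> and \<open>w\<close> exchanged.\<close>
  then have "z = rot60 \<or> rot60 * z = 1"
    using re by (auto simp: rot60_def complex_eq_iff)
  then show ?thesis
  proof
    assume "rot60 * z = 1"
    then have "rot60 * (w - v) = u - v" by (simp add: w mult.assoc[symmetric])
    then show ?thesis by (simp add: algebra_simps)
  qed (use w in \<open>simp add: algebra_simps\<close>)
qed

text \<open>Fixing the sense of rotation selects one of the two other vertices of each triangle at
  \<open>v\<close>, so a triangle is counted once rather than twice.\<close>

definition rot_degree :: "complex set \<Rightarrow> complex \<Rightarrow> nat" where
  "rot_degree V v = card {u \<in> V. u \<noteq> v \<and> v + rot60 * (u - v) \<in> V}"

lemma card_equilateral_at_le: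
  assumes "finite V"
  shows "card {P \<in> equilateral_sets. P \<subseteq> V \<and> v \<in> P} \<le> rot_degree V v"
proof -
  let ?E = "{u \<in> V. u \<noteq> v \<and> v + rot60 * (u - v) \<in> V}"
  have aux: "P \<in> (\<lambda>u. {v, u, v + rot60 * (u - v)}) ` ?E"
    if "P = {v, b, c}" "P \<subseteq> V" "v \<noteq> b" "v \<noteq> c" "dist v b = dist b c" "dist b c = dist v c"
    for P b c
  proof -
    have "c = v + rot60 * (b - v) \<or> b = v + rot60 * (c - v)"
      using equilateral_rot60[of v b c] that by auto
    then show ?thesis
    proof
      assume c: "c = v + rot60 * (b - v)"
      then have "b \<in> ?E" using that by simp
      then show ?thesis by (rule rev_image_eqI) (use that c in simp)
    next
      assume b: "b = v + rot60 * (c - v)"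
      then have "c \<in> ?E" using that by simp
      then show ?thesis by (rule rev_image_eqI) (use that b in \<open>simp add: insert_commute\<close>)
    qed
  qed
  have "{P \<in> equilateral_sets. P \<subseteq> V \<and> v \<in> P} \<subseteq> (\<lambda>u. {v, u, v + rot60 * (u - v)}) ` ?E"
  proof
    fix P assume "P \<in> {P \<in> equilateral_sets. P \<subseteq> V \<and> v \<in> P}"
    then obtain a b c where P: "P = {a, b, c}" "card P = 3" "dist a b = dist b c"
        "dist b c = dist a c" "P \<subseteq> V" "v \<in> P"
      by (auto simp: equilateral_sets_def)
    have ne: "a \<noteq> b" "b \<noteq> c" "a \<noteq> c" using P(1,2) by (auto simp: card_insert_if split: if_splits)
    consider "v = a" | "v = b" | "v = c" using P by auto
    then show "P \<in> (\<lambda>u. {v, u, v + rot60 * (u - v)}) ` ?E"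
    proof cases
      case 1 then show ?thesis using P ne by (intro aux[of _ b c]) auto
    next
      case 2 then show ?thesis using P ne by (intro aux[of _ a c]) (auto simp: dist_commute)
    next
      case 3 then show ?thesis using P ne by (intro aux[of _ a b]) (auto simp: dist_commute)
    qed
  qed
  then show ?thesis
    unfolding rot_degree_def using assms surj_card_le[of ?E] by simp
qed

text \<open>Double counting of incidences: each triangle in \<open>V\<close> has three
  vertices.\<close>

lemma three_S_E_set_le:
  assumes "finite V"
  shows "3 * S_E_set V \<le> (\<Sum>v\<in>V. rot_degree V v)"
proof -
  let ?T = "{P \<in> equilateral_sets. P \<subseteq> V}"
  have fin: "finite ?T" using assms by (auto intro: finite_subset[of _ "Pow V"])
  have "3 * S_E_set V = (\<Sum>P\<in>?T. card {v \<in> V. v \<in> P})"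
  proof -
    have "card {v \<in> V. v \<in> P} = 3" if "P \<in> ?T" for P
    proof -
      have "{v \<in> V. v \<in> P} = P" using that by auto
      then show ?thesis using that by (auto simp: equilateral_sets_def)
    qed
    then show ?thesis by (simp add: S_E_set_def)
  qed
  also have "\<dots> = (\<Sum>v\<in>V. card {P \<in> ?T. v \<in> P})"
    by (rule sum_multicount_gen[OF assms fin, symmetric]) simp
  also have "\<dots> \<le> (\<Sum>v\<in>V. rot_degree V v)"
    using card_equilateral_at_le[OF assms] by (intro sum_mono) (simp add: conj_assoc)
  finally show ?thesis .
qed

section \<open>Degree bounds from the rotated orders\<close>

lemma rot_degree_le:
  assumes "finite V" "c \<noteq> 0"
  shows "rot_degree V v \<le> num_above V c v + num_above V (c * rot60\<^sup>2) v"
proof -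
  let ?E = "{u \<in> V. u \<noteq> v \<and> v + rot60 * (u - v) \<in> V}"
  let ?A = "{u \<in> V. lex_pos (c * (u - v))}" and ?B = "{u \<in> V. lex_pos (c * rot60\<^sup>2 * (u - v))}"
  let ?r = "\<lambda>u. v + rot60 * (u - v)"
  have "?E \<subseteq> ?A \<union> {u \<in> ?E. ?r u \<in> ?B}"
  proof
    fix u assume u: "u \<in> ?E"
    \<comment> \<open>Since \<open>rot60 ^ 3 = - 1\<close>, the rotated point is above
      \<open>v\<close> in the second order exactly when \<open>u\<close> is not above
      \<open>v\<close> in the first.\<close>
    have "c * rot60\<^sup>2 * (?r u - v) = rot60 ^ 3 * (c * (u - v))"
      by (simp add: power2_eq_square power3_eq_cube)
    then have "lex_pos (c * rot60\<^sup>2 * (?r u - v)) \<longleftrightarrow> \<not> lex_pos (c * (u - v))"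
      using u assms(2) lex_pos_minus_iff[of "c * (u - v)"] by (simp add: rot60_cube)
    then show "u \<in> ?A \<union> {u \<in> ?E. ?r u \<in> ?B}" using u by auto
  qed
  then have "card ?E \<le> card (?A \<union> {u \<in> ?E. ?r u \<in> ?B})"
    using assms(1) by (intro card_mono) auto
  also have "\<dots> \<le> card ?A + card {u \<in> ?E. ?r u \<in> ?B}" by (rule card_Un_le)
  also have "card {u \<in> ?E. ?r u \<in> ?B} \<le> card ?B"
    using assms(1) by (intro card_inj_on_le[of ?r]) (auto simp: inj_on_def)
  finally show ?thesis by (simp add: rot_degree_def num_above_def)
qed

definition depth :: "complex set \<Rightarrow> complex \<Rightarrow> complex \<Rightarrow> nat" where
  "depth V c v = min (num_above V c v) (card V - 1 - num_above V c v)"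

text \<open>Two of the three depths are attained on the same side, and their sum bounds the degree;
  the \<open>max\<close> in the remaining term absorbs \<open>q\<close>, whatever its value.\<close>

lemma rot_degree_depth:
  fixes q :: nat
  assumes "finite V" "v \<in> V"
  shows "rot_degree V v + q \<le> (\<Sum>j<3. max (depth V ((rot60\<^sup>2) ^ j) v) q)"
proof -
  let ?c = "\<lambda>j. (rot60\<^sup>2) ^ j"
  have c: "?c j \<noteq> 0" for j by simp
  have cyc: "?c 0 * rot60\<^sup>2 = ?c 1" "?c 1 * rot60\<^sup>2 = ?c 2" "?c 2 * rot60\<^sup>2 = ?c 0"
  proof -
    have "?c 2 * rot60\<^sup>2 = (rot60 ^ 3)\<^sup>2" by (simp flip: power_mult power_add)
    then show "?c 2 * rot60\<^sup>2 = ?c 0" by (simp add: rot60_cube)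
  qed (simp_all add: power2_eq_square)
  have up: "rot_degree V v \<le> num_above V (?c 0) v + num_above V (?c 1) v"
    "rot_degree V v \<le> num_above V (?c 1) v + num_above V (?c 2) v"
    "rot_degree V v \<le> num_above V (?c 2) v + num_above V (?c 0) v"
    using rot_degree_le[OF assms(1) c, of v 0] rot_degree_le[OF assms(1) c, of v 1]
      rot_degree_le[OF assms(1) c, of v 2] unfolding cyc by blast+
  have c': "- ?c j \<noteq> 0" for j by simp
  have down: "rot_degree V v \<le> num_above V (- ?c 0) v + num_above V (- ?c 1) v"
    "rot_degree V v \<le> num_above V (- ?c 1) v + num_above V (- ?c 2) v"
    "rot_degree V v \<le> num_above V (- ?c 2) v + num_above V (- ?c 0) v"
    using rot_degree_le[OF assms(1) c', of v 0] rot_degree_le[OF assms(1) c', of v 1]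
      rot_degree_le[OF assms(1) c', of v 2] unfolding mult_minus_left cyc by blast+
  have d: "depth V (?c j) v = min (num_above V (?c j) v) (num_above V (- ?c j) v)" for j
    unfolding depth_def using num_above_add_minus[OF assms c, of j] by arith
  have "(\<Sum>j<3. max (depth V (?c j) v) q)
      = max (depth V (?c 0) v) q + max (depth V (?c 1) v) q + max (depth V (?c 2) v) q"
    by (simp add: numeral_3_eq_3 numeral_2_eq_2)
  then show ?thesis
    unfolding d using up down by linarith
qed

section \<open>Sums over ranks\<close>

lemma sum_min_reflect_le: "4 * (\<Sum>k<n. min k (n - 1 - k)) \<le> (n - 1)\<^sup>2" for n :: nat
proof (induction n rule: induct_nat_012)
  case (ge2 n)
  \<comment> \<open>Both end terms vanish, and every inner term exceeds its counterpart for
    \<open>n\<close> by 1; hence the induction in steps of two.\<close>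
  have "(\<Sum>k<Suc (Suc n). min k (Suc (Suc n) - 1 - k)) = (\<Sum>k<n. min (Suc k) (n - k))"
    unfolding lessThan_Suc_atMost by (subst sum.atMost_Suc_shift) (simp flip: lessThan_Suc_atMost)
  also have "\<dots> = (\<Sum>k<n. min k (n - 1 - k) + 1)"
    by (intro sum.cong) auto
  also have "\<dots> = (\<Sum>k<n. min k (n - 1 - k)) + n"
    by (simp only: sum.distrib) simp
  finally have "4 * (\<Sum>k<Suc (Suc n). min k (Suc (Suc n) - 1 - k)) \<le> (n - 1)\<^sup>2 + 4 * n"
    using ge2(1) by simp
  also have "\<dots> \<le> (Suc (Suc n) - 1)\<^sup>2"
    by (cases n) (auto simp: power2_eq_square)
  finally show ?case .
qed auto

text \<open>Subtraction is truncated, so the nonzero terms are among \<open>q\<close>,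
  \<open>q - 1\<close>, ..., 1.\<close>

lemma sum_truncated_diff_le: "2 * (\<Sum>k<n. q - k) \<le> q * (q + 1)" for n q :: nat
proof (induction q)
  case (Suc q)
  have "(\<Sum>k<n. Suc q - k) \<le> (\<Sum>k<n. (q - k) + (if k \<le> q then 1 else 0))"
    by (intro sum_mono) auto
  also have "\<dots> = (\<Sum>k<n. q - k) + card ({..<n} \<inter> {k. k \<le> q})"
    by (simp add: sum.distrib sum.If_cases)
  also have "card ({..<n} \<inter> {k. k \<le> q}) \<le> card {..q}"
    by (intro card_mono) auto
  finally show ?case using Suc by simp
qed auto

lemma sum_max_min_reflect_le:
  "4 * (\<Sum>k<n. max (min k (n - 1 - k)) q) \<le> (n - 1)\<^sup>2 + 4 * q * (q + 1)" for n q :: nat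
proof -
  \<comment> \<open>With truncated subtraction \<open>max m q = m + (q - m)\<close>, and here
    \<open>m\<close> is one of \<open>k\<close> and \<open>n - 1 - k\<close>.\<close>
  have "(\<Sum>k<n. max (min k (n - 1 - k)) q)
      \<le> (\<Sum>k<n. min k (n - 1 - k) + (q - k) + (q - (n - 1 - k)))"
    by (intro sum_mono) auto
  also have "\<dots> = (\<Sum>k<n. min k (n - 1 - k)) + (\<Sum>k<n. q - k) + (\<Sum>k<n. q - (n - 1 - k))"
    by (simp add: sum.distrib)
  also have "(\<Sum>k<n. q - (n - 1 - k)) = (\<Sum>k<n. q - k)"
    using sum.nat_diff_reindex[of "\<lambda>k. q - k" n] by simp
  finally show ?thesis
    using sum_min_reflect_le[of n] sum_truncated_diff_le[where n = n and q = q] by (simp add: algebra_simps)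
qed

section \<open>Choice of the threshold and the final estimate\<close>

lemma S_E_set_le:
  assumes "finite V" "card V = n" "n \<ge> 1"
  shows "18 * int (S_E_set V) \<le> (4 * int n - 1) * (int n - 1)"
proof -
  \<comment> \<open>In the bound \<open>main\<close> below,
    \<open>12 * q * (q + 1) - 4 * n * q\<close> changes by \<open>24 * q - 4 * n\<close> from
    \<open>q - 1\<close> to \<open>q\<close>, so \<open>n div 6\<close> minimises it.\<close>
  define q r where "q = n div 6" and "r = n mod 6"
  have n: "n = 6 * q + r" and r: "r < 6" by (auto simp: q_def r_def)
  let ?c = "\<lambda>j. (rot60\<^sup>2) ^ j"
  let ?G = "\<Sum>k<n. max (min k (n - 1 - k)) q"
  have G: "(\<Sum>v\<in>V. max (depth V (?c j) v) q) = ?G" for j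
    using sum.reindex_bij_betw[OF bij_betw_num_above[OF assms(1), of "?c j"],
        of "\<lambda>k. max (min k (n - 1 - k)) q"] assms(2)
    by (simp add: depth_def)
  have "3 * S_E_set V + n * q \<le> (\<Sum>v\<in>V. rot_degree V v + q)"
    using three_S_E_set_le[OF assms(1)] assms(2) by (simp add: sum.distrib)
  also have "\<dots> \<le> (\<Sum>v\<in>V. \<Sum>j<3. max (depth V (?c j) v) q)"
    by (intro sum_mono rot_degree_depth assms)
  also have "\<dots> = 3 * ?G"
    by (subst sum.swap) (simp add: G)
  finally have "4 * (3 * S_E_set V + n * q) \<le> 3 * ((n - 1)\<^sup>2 + 4 * q * (q + 1))"
    using mult_le_mono2[OF sum_max_min_reflect_le[where n = n and q = q], of 3] by simp
  then have "int (4 * (3 * S_E_set V + n * q)) \<le> int (3 * ((n - 1)\<^sup>2 + 4 * q * (q + 1)))"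
    by (simp only: of_nat_le_iff)
  then have main: "12 * int (S_E_set V)
      \<le> 3 * (int n - 1)\<^sup>2 + 12 * int q * (int q + 1) - 4 * int n * int q"
    using assms(3) by (simp add: of_nat_diff algebra_simps)
  \<comment> \<open>The right side minus the left side of the next inequality is
    \<open>12 * q - (r - 1) * (r - 7)\<close>. Only \<open>r = 0\<close> makes the product positive,
    and then \<open>n \<ge> 1\<close> forces \<open>q \<ge> 1\<close>.\<close>
  have "(int r - 1) * (int r - 7) \<le> 12 * int q"
  proof -
    have "r = 0 \<or> r = 1 \<or> r = 2 \<or> r = 3 \<or> r = 4 \<or> r = 5" using r by arith
    then show ?thesis using assms(3) n by auto
  qed
  then have "3 * (3 * (int n - 1)\<^sup>2 + 12 * int q * (int q + 1) - 4 * int n * int q)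
      \<le> 2 * ((4 * int n - 1) * (int n - 1))"
    unfolding n by (simp add: power2_eq_square algebra_simps)
  moreover have "18 * s \<le> x" if "12 * s \<le> y" "3 * y \<le> 2 * x" for s x y :: int
    using that by linarith
  ultimately show ?thesis using main by blast
qed

theorem theorem1:
  fixes n :: nat
  assumes "n \<ge> 1"
  shows "real (S_E n) \<le> of_int \<lfloor>(4 * real n - 1) * (real n - 1) / 18\<rfloor>"
proof -
  let ?S = "{S_E_set V | V. finite V \<and> card V = n}"
  have bound: "18 * int k \<le> (4 * int n - 1) * (int n - 1)" if "k \<in> ?S" for k
    using that S_E_set_le assms by auto
  \<comment> \<open>The bound itself makes the set of counts finite; with nonemptiness,
    \<open>Max\<close> is then an attained value.\<close>
  have "?S \<subseteq> {..nat ((4 * int n - 1) * (int n - 1))}"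
    using bound by fastforce
  then have "finite ?S" by (rule finite_subset) simp
  moreover obtain V :: "complex set" where "finite V" "card V = n"
    using infinite_arbitrarily_large[OF infinite_UNIV_char_0] by blast
  then have "?S \<noteq> {}" by blast
  ultimately have "S_E n \<in> ?S"
    unfolding S_E_def by (rule Max_in)
  then have "real_of_int (18 * int (S_E n)) \<le> real_of_int ((4 * int n - 1) * (int n - 1))"
    using bound by (simp only: of_int_le_iff)
  then have "of_int (int (S_E n)) \<le> (4 * real n - 1) * (real n - 1) / 18"
    by simp
  \<comment> \<open>The count is an integer, so the floor costs nothing.\<close>
  then have "int (S_E n) \<le> \<lfloor>(4 * real n - 1) * (real n - 1) / 18\<rfloor>"
    by (simp only: le_floor_iff)
  then show ?thesis by linarith
qed

end
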